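(* (Lumin's 2nd Theorem) Let $n,m,x\in\mathbb N$ and consider the underlying Jaco graphs $J^*_n(x)$ and $J^*_m(x)$. Label the vertices of the disjoint union $J^*_n(x)\cup J^*_m(x)$ as $v_1,\dots,v_n$ (the vertices of $J^*_n(x)$ in their Jaco order) and $v_{n+1},\dots,v_{n+m}$ (the vertices of $J^*_m(x)$ in their Jaco order), and let $\ell=\Delta(J^*_m(x))$. Then $$irr_t(J^*_n(x)\cup J^*_m(x)) \le 2\big(irr_t(J^*_n(x))+irr_t(J^*_m(x))\big) + \sum_{i=\ell+1}^{n}\sum_{j=n+\ell+1}^{n+m}|d(v_i)-d(v_j)| \quad\text{if } n>m,$$ and $$irr_t(J^*_n(x)\cup J^*_m(x)) = 4\,irr_t(J^*_n(x)) \quad\text{if } n=m.$$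
   Context: The infinite Jaco graph $J_\infty(x)$ is the directed graph with vertex set $\{v_i : i\in\mathbb N\}$, whose arcs are pairs $(v_i,v_j)$ with $i<j$, where $(v_i,v_j)$ is an arc if and only if $2i - d^-(v_i)\ge j$ ($d^-$ denotes in-degree). The finite Jaco graph $J_n(x)$ is the subgraph of $J_\infty(x)$ induced on $v_1,\dots,v_n$, and $J^*_n(x)$ denotes its underlying simple undirected graph. For a simple undirected graph $G$ with vertices $v_1,\dots,v_N$, the total irregularity is $irr_t(G)=\sum_{i=1}^{N-1}\sum_{j=i+1}^{N}|d(v_i)-d(v_j)|$ (and $0$ for a single vertex). $G\cup H$ denotes the disjoint union. *)

theory Defs
  imports "Graph_Theory.Graph_Theory"
begin

section \<open>Jaco graphs\<close>

text \<open>The vertex \<open>v\<^sub>i\<close>, \<open>i \<ge> 1\<close>, is the number \<open>i\<close>. The arc condition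
  \<open>2 i - d\<^sup>-(v\<^sub>i) \<ge> j\<close> mentions the in-degree of the graph being defined; as all arcs go from
  smaller to larger indices, the in-degrees are determined by well-founded recursion. The lemmas
  \<open>jaco_infinite_arc_iff\<close> and \<open>jaco_infinite_unique\<close> show that \<open>jaco_infinite\<close> is the
  one and only digraph satisfying that condition.\<close>

context
  notes conj_cong [fundef_cong]
begin

fun jaco_indeg :: "nat \<Rightarrow> nat" where
  "jaco_indeg j = card {i. 1 \<le> i \<and> i < j \<and> 2 * int i - int (jaco_indeg i) \<ge> int j}"

end

declare jaco_indeg.simps [simp del]

text \<open>The parameter \<open>x\<close> is only the formal argument of the function \<open>f(x) = x\<close> that gives
  rise to the family \<open>J\<^sub>n(x)\<close>; the graphs do not depend on it.\<close>

definition jaco_infinite :: "nat \<Rightarrow> nat pair_pre_digraph" where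
  "jaco_infinite x =
     \<lparr> pverts = {1..},
       parcs = {(i, j). 1 \<le> i \<and> i < j \<and> 2 * int i - int (jaco_indeg i) \<ge> int j} \<rparr>"

lemma in_degree_with_proj: "in_degree (with_proj G) v = card {u. (u, v) \<in> parcs G}"
proof -
  have "in_arcs (with_proj G) v = (\<lambda>u. (u, v)) ` {u. (u, v) \<in> parcs G}"
    by (auto simp: in_arcs_def)
  then show ?thesis
    by (simp add: in_degree_def card_image inj_on_def)
qed

lemma in_degree_jaco_infinite: "in_degree (with_proj (jaco_infinite x)) i = jaco_indeg i"
  by (subst jaco_indeg.simps) (simp add: in_degree_with_proj jaco_infinite_def)

lemma jaco_infinite_arc_iff:
  "(i, j) \<in> parcs (jaco_infinite x) \<longleftrightarrow>
     1 \<le> i \<and> i < j \<and> 2 * int i - int (in_degree (with_proj (jaco_infinite x)) i) \<ge> int j"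
  unfolding in_degree_jaco_infinite by (simp add: jaco_infinite_def)

lemma jaco_infinite_unique:
  fixes G :: "nat pair_pre_digraph"
  assumes verts: "pverts G = {1..}"
    and arcs: "\<And>i j. (i, j) \<in> parcs G \<longleftrightarrow>
      1 \<le> i \<and> i < j \<and> 2 * int i - int (in_degree (with_proj G) i) \<ge> int j"
  shows "G = jaco_infinite x"
proof -
  have deg: "in_degree (with_proj G) j = jaco_indeg j" for j
  proof (induction j rule: less_induct)
    case (less j)
    have "in_degree (with_proj G) j =
        card {i. 1 \<le> i \<and> i < j \<and> 2 * int i - int (in_degree (with_proj G) i) \<ge> int j}"
      by (subst in_degree_with_proj) (simp only: arcs)
    also have "\<dots> = card {i. 1 \<le> i \<and> i < j \<and> 2 * int i - int (jaco_indeg i) \<ge> int j}"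
      using less by (intro arg_cong [where f = card]) auto
    finally show ?case
      by (simp add: jaco_indeg.simps [of j])
  qed
  have "parcs G = parcs (jaco_infinite x)"
    by (auto simp: arcs deg jaco_infinite_def)
  then show ?thesis
    using verts by (cases G) (simp add: jaco_infinite_def)
qed

definition jaco :: "nat \<Rightarrow> nat \<Rightarrow> (nat, nat \<times> nat) pre_digraph" where
  "jaco x n = with_proj (jaco_infinite x) \<restriction> {1..n}"

text \<open>As everywhere in \<open>Graph_Theory\<close>, a simple undirected graph is a loop-free symmetric
  digraph: an edge \<open>uv\<close> is the pair of opposite arcs \<open>(u, v)\<close> and \<open>(v, u)\<close>.\<close>

definition jaco_underlying :: "nat \<Rightarrow> nat \<Rightarrow> nat pair_pre_digraph" where
  "jaco_underlying x n = mk_symmetric (jaco x n)"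

lemma pverts_jaco_underlying: "pverts (jaco_underlying x n) = {1..n}"
  by (auto simp: jaco_underlying_def jaco_def)

lemma pair_graph_jaco_underlying: "pair_graph (jaco_underlying x n)"
proof -
  have fin: "finite (parcs (jaco_underlying x n))"
    by (rule finite_subset [of _ "{1..n} \<times> {1..n}"])
      (auto simp: jaco_underlying_def jaco_def mk_symmetric_def induce_subgraph_def)
  show ?thesis
    using fin
    by unfold_locales
      (auto simp: jaco_underlying_def jaco_def mk_symmetric_def induce_subgraph_def
        jaco_infinite_def symmetric_def intro!: symI)
qed

section \<open>Degrees, total irregularity and disjoint unions of simple graphs\<close>

text \<open>In a symmetric digraph the out-arcs of a vertex correspond to its incident edges.\<close>

definition degree :: "'a pair_pre_digraph \<Rightarrow> 'a \<Rightarrow> nat" where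
  "degree G v = out_degree (with_proj G) v"

definition max_degree :: "'a pair_pre_digraph \<Rightarrow> nat" where
  "max_degree G = Max (degree G ` pverts G)"

definition labelling :: "'a pair_pre_digraph \<Rightarrow> (nat \<Rightarrow> 'a) \<Rightarrow> bool" where
  "labelling G v \<longleftrightarrow> bij_betw v {1..card (pverts G)} (pverts G)"

text \<open>The total irregularity is defined through an arbitrary labelling \<open>v\<^sub>1, \<dots>, v\<^sub>N\<close> of the
  vertices; \<open>irr_t_labelling\<close> shows that the choice is immaterial.\<close>

definition irr_t :: "'a pair_pre_digraph \<Rightarrow> int" where
  "irr_t G = (let v = (SOME v. labelling G v); N = card (pverts G) in
     \<Sum>i=1..N - 1. \<Sum>j=i + 1..N. \<bar>int (degree G (v i)) - int (degree G (v j))\<bar>)"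

definition disjoint_union ::
    "'a pair_pre_digraph \<Rightarrow> 'b pair_pre_digraph \<Rightarrow> ('a + 'b) pair_pre_digraph" where
  "disjoint_union G H =
     \<lparr> pverts = pverts G <+> pverts H,
       parcs = map_prod Inl Inl ` parcs G \<union> map_prod Inr Inr ` parcs H \<rparr>"

lemma sum_pairs_symmetric:
  fixes f :: "nat \<Rightarrow> nat \<Rightarrow> int"
  assumes sym: "\<And>i j. f i j = f j i" and diag: "\<And>i. f i i = 0"
  shows "2 * (\<Sum>i=1..N - 1. \<Sum>j=i + 1..N. f i j) = (\<Sum>i=1..N. \<Sum>j=1..N. f i j)"
proof -
  have "(\<Sum>i=1..N - 1. \<Sum>j=i + 1..N. f i j) = (\<Sum>i=1..N. \<Sum>j=i + 1..N. f i j)"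
    by (rule sum.mono_neutral_left) auto
  moreover have "2 * (\<Sum>i=1..N. \<Sum>j=i + 1..N. f i j) = (\<Sum>i=1..N. \<Sum>j=1..N. f i j)"
  proof (induction N)
    case (Suc N)
    have "(\<Sum>i=1..Suc N. \<Sum>j=i + 1..Suc N. f i j) =
        (\<Sum>i=1..N. (\<Sum>j=i + 1..N. f i j) + f i (Suc N))"
      by simp
    then show ?case
      using Suc by (simp add: sum.distrib diag sym [of "Suc N"])
  qed simp
  ultimately show ?thesis by simp
qed

lemma irr_t_labelling:
  assumes "finite (pverts G)" and "labelling G v"
  shows "irr_t G = (\<Sum>i=1..card (pverts G) - 1. \<Sum>j=i + 1..card (pverts G).
    \<bar>int (degree G (v i)) - int (degree G (v j))\<bar>)"
proof -
  define N where "N = card (pverts G)"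
  define S where "S w = (\<Sum>i=1..N - 1. \<Sum>j=i + 1..N.
    \<bar>int (degree G (w i)) - int (degree G (w j))\<bar>)" for w
  have S: "2 * S w = (\<Sum>a\<in>pverts G. \<Sum>b\<in>pverts G. \<bar>int (degree G a) - int (degree G b)\<bar>)"
    if "labelling G w" for w
  proof -
    have w: "bij_betw w {1..N} (pverts G)"
      using that by (simp add: labelling_def N_def)
    have "2 * S w = (\<Sum>i=1..N. \<Sum>j=1..N. \<bar>int (degree G (w i)) - int (degree G (w j))\<bar>)"
      unfolding S_def by (rule sum_pairs_symmetric) auto
    also have "\<dots> = (\<Sum>i=1..N. \<Sum>b\<in>pverts G. \<bar>int (degree G (w i)) - int (degree G b)\<bar>)"
      by (intro sum.cong refl
        sum.reindex_bij_betw [OF w, where g = "\<lambda>b. \<bar>int (degree G (w _)) - int (degree G b)\<bar>"])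
    also have "\<dots> = (\<Sum>a\<in>pverts G. \<Sum>b\<in>pverts G. \<bar>int (degree G a) - int (degree G b)\<bar>)"
      by (rule sum.reindex_bij_betw [OF w])
    finally show ?thesis .
  qed
  have "labelling G (SOME v. labelling G v)"
    using assms(2) by (metis someI_ex)
  then have "S (SOME v. labelling G v) = S v"
    using S assms(2) by (metis mult_cancel_left zero_neq_numeral)
  then show ?thesis
    by (simp add: irr_t_def S_def N_def Let_def)
qed

end

theory Submission
  imports Defs
begin

text \<open>The degree of \<open>v\<^sub>i\<close> in \<open>J\<^sup>*\<^sub>n\<close> is \<open>min i (n - i + d\<^sup>-(v\<^sub>i))\<close>. As \<open>d\<^sup>-(v\<^sub>i)\<close> grows by at most one
  with each step of \<open>i\<close>, it follows that \<open>d(v\<^sub>i) = i\<close> for all \<open>i \<le> \<ell>\<close>, in \<open>J\<^sup>*\<^sub>m\<close> as well as in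
  \<open>J\<^sup>*\<^sub>n\<close>. Hence both degree sequences start with the same block \<open>P = (1, \<dots>, \<ell>)\<close>; call the
  remaining parts \<open>R\<close> and \<open>T\<close>. With \<open>S(X, Y)\<close> for the sum of all \<open>\<bar>x - y\<bar>\<close>, expanding the total
  irregularities along these blocks shows that the right-hand side of the inequality exceeds the
  left-hand side by exactly \<open>(S(R, R) + S(T, T)) / 2\<close>.\<close>

section \<open>Disjoint unions and double sums over blocks\<close>

lemma degree_eq_card: "degree G v = card {w. (v, w) \<in> parcs G}"
proof -
  have "out_arcs (with_proj G) v = Pair v ` {w. (v, w) \<in> parcs G}"
    by (auto simp: out_arcs_def)
  then show ?thesis
    by (simp add: degree_def out_degree_def card_image inj_on_def)
qed

lemma degree_disjoint_union_Inl [simp]: "degree (disjoint_union G H) (Inl a) = degree G a"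
proof -
  have "{w. (Inl a, w) \<in> parcs (disjoint_union G H)} = Inl ` {w. (a, w) \<in> parcs G}"
    by (force simp: disjoint_union_def)
  then show ?thesis
    by (simp add: degree_eq_card card_image)
qed

lemma degree_disjoint_union_Inr [simp]: "degree (disjoint_union G H) (Inr b) = degree H b"
proof -
  have "{w. (Inr b, w) \<in> parcs (disjoint_union G H)} = Inr ` {w. (b, w) \<in> parcs H}"
    by (force simp: disjoint_union_def)
  then show ?thesis
    by (simp add: degree_eq_card card_image)
qed

text \<open>Two functions and two index types allow degrees in different graphs to be compared. For
  \<open>f = g\<close> and \<open>X = Y\<close> every unordered pair counts twice, hence the factors
  2 below.\<close>

definition abs_diff_sum :: "('a \<Rightarrow> int) \<Rightarrow> ('b \<Rightarrow> int) \<Rightarrow> 'a set \<Rightarrow> 'b set \<Rightarrow> int" where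
  "abs_diff_sum f g X Y = (\<Sum>a\<in>X. \<Sum>b\<in>Y. \<bar>f a - g b\<bar>)"

lemma abs_diff_sum_nonneg: "0 \<le> abs_diff_sum f g X Y"
  by (simp add: abs_diff_sum_def sum_nonneg)

lemma abs_diff_sum_commute: "abs_diff_sum f g X Y = abs_diff_sum g f Y X"
  unfolding abs_diff_sum_def
  by (subst sum.swap) (simp add: abs_minus_commute)

lemma abs_diff_sum_Un_left:
  assumes "finite X" "finite X'" "X \<inter> X' = {}"
  shows "abs_diff_sum f g (X \<union> X') Y = abs_diff_sum f g X Y + abs_diff_sum f g X' Y"
  using assms by (simp add: abs_diff_sum_def sum.union_disjoint)

lemma abs_diff_sum_Un_right:
  assumes "finite Y" "finite Y'" "Y \<inter> Y' = {}"
  shows "abs_diff_sum f g X (Y \<union> Y') = abs_diff_sum f g X Y + abs_diff_sum f g X Y'"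
  using abs_diff_sum_Un_left [OF assms] by (metis abs_diff_sum_commute)

lemma abs_diff_sum_cong:
  assumes "\<And>a. a \<in> X \<Longrightarrow> f a = f' a" and "\<And>b. b \<in> Y \<Longrightarrow> g b = g' b"
  shows "abs_diff_sum f g X Y = abs_diff_sum f' g' X Y"
  using assms by (simp add: abs_diff_sum_def)

text \<open>Passing to ordered pairs removes the labelling, so the sum can be split along any
  partition of the vertices.\<close>

lemma irr_t_eq_abs_diff_sum:
  assumes "finite (pverts G)"
  shows "2 * irr_t G =
    abs_diff_sum (\<lambda>a. int (degree G a)) (\<lambda>a. int (degree G a)) (pverts G) (pverts G)"
proof -
  obtain v where v: "bij_betw v {1..card (pverts G)} (pverts G)"
    using ex_bij_betw_nat_finite_1 [OF assms] by blast
  let ?d = "\<lambda>a. int (degree G a)" and ?N = "card (pverts G)"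
  have "2 * irr_t G = (\<Sum>i=1..?N. \<Sum>j=1..?N. \<bar>?d (v i) - ?d (v j)\<bar>)"
    using irr_t_labelling [OF assms, of v] v
      sum_pairs_symmetric [of "\<lambda>i j. \<bar>?d (v i) - ?d (v j)\<bar>" ?N]
    by (simp add: labelling_def abs_minus_commute)
  also have "\<dots> = (\<Sum>i=1..?N. \<Sum>b\<in>pverts G. \<bar>?d (v i) - ?d b\<bar>)"
    by (intro sum.cong refl
      sum.reindex_bij_betw [OF v, where g = "\<lambda>b. \<bar>?d (v _) - ?d b\<bar>"])
  also have "\<dots> = (\<Sum>a\<in>pverts G. \<Sum>b\<in>pverts G. \<bar>?d a - ?d b\<bar>)"
    by (rule sum.reindex_bij_betw [OF v])
  finally show ?thesis
    by (simp add: abs_diff_sum_def)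
qed

text \<open>Over ordered pairs the sum for the union splits into four blocks; the two mixed ones
  agree by symmetry, and halving leaves one of them.\<close>

lemma irr_t_disjoint_union:
  assumes "finite (pverts G)" and "finite (pverts H)"
  shows "irr_t (disjoint_union G H) = irr_t G + irr_t H +
    abs_diff_sum (\<lambda>a. int (degree G a)) (\<lambda>b. int (degree H b)) (pverts G) (pverts H)"
proof -
  let ?U = "disjoint_union G H"
  have fin: "finite (pverts ?U)"
    using assms by (simp add: disjoint_union_def)
  have sum_Plus: "(\<Sum>a\<in>pverts ?U. h a) =
      (\<Sum>a\<in>pverts G. h (Inl a)) + (\<Sum>b\<in>pverts H. h (Inr b))" for h :: "'a + 'b \<Rightarrow> int"
    using assms by (simp add: disjoint_union_def sum.Plus)
  have "2 * irr_t ?U = 2 * irr_t G + 2 * irr_t H +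
      abs_diff_sum (\<lambda>a. int (degree G a)) (\<lambda>b. int (degree H b)) (pverts G) (pverts H) +
      abs_diff_sum (\<lambda>b. int (degree H b)) (\<lambda>a. int (degree G a)) (pverts H) (pverts G)"
    by (simp add: irr_t_eq_abs_diff_sum [OF fin] irr_t_eq_abs_diff_sum assms)
      (simp add: abs_diff_sum_def sum_Plus sum.distrib)
  then show ?thesis
    using abs_diff_sum_commute [of "\<lambda>b. int (degree H b)" "\<lambda>a. int (degree G a)"]
    by simp
qed

section \<open>Degree sequences of Jaco graphs\<close>

lemma jaco_indeg_le: "jaco_indeg j \<le> j - 1"
proof -
  have "jaco_indeg j \<le> card {1..<j}"
    by (subst jaco_indeg.simps) (intro card_mono, auto)
  then show ?thesis by simp
qed

text \<open>The arcs leaving a fixed \<open>i\<close> reach up to a bound that depends on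
  \<open>i\<close> alone. So an \<open>i < j\<close> with an arc to \<open>Suc j\<close> also has
  one to \<open>j\<close>, and only \<open>j\<close> itself can be a new in-neighbour.\<close>

lemma jaco_indeg_Suc_le: "jaco_indeg (Suc j) \<le> Suc (jaco_indeg j)"
proof -
  let ?A = "{i. 1 \<le> i \<and> i < j \<and> 2 * int i - int (jaco_indeg i) \<ge> int j}"
  have "finite ?A"
    by (rule finite_subset [of _ "{..<j}"]) auto
  then have "jaco_indeg (Suc j) \<le> card (insert j ?A)"
    by (subst jaco_indeg.simps) (intro card_mono, auto)
  also have "\<dots> \<le> Suc (card ?A)"
    by (rule card_insert_le_m1) auto
  finally show ?thesis
    by (simp add: jaco_indeg.simps [of j])
qed

lemma jaco_indeg_add_le: "jaco_indeg (j + k) \<le> jaco_indeg j + k"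
proof (induction k)
  case (Suc k)
  then show ?case
    using jaco_indeg_Suc_le [of "j + k"] by simp
qed simp

lemma parcs_jaco_underlying:
  "(i, j) \<in> parcs (jaco_underlying x n) \<longleftrightarrow> i \<in> {1..n} \<and> j \<in> {1..n} \<and>
     (i < j \<and> int j \<le> 2 * int i - int (jaco_indeg i) \<or>
      j < i \<and> int i \<le> 2 * int j - int (jaco_indeg j))"
  by (auto simp: jaco_underlying_def jaco_def mk_symmetric_def induce_subgraph_def
    jaco_infinite_def arcs_ends_def arc_to_ends_def)

lemma degree_jaco_underlying:
  assumes "i \<in> {1..n}"
  shows "degree (jaco_underlying x n) i = min i (n - i + jaco_indeg i)"
proof -
  let ?A = "{j. 1 \<le> j \<and> j < i \<and> 2 * int j - int (jaco_indeg j) \<ge> int i}"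
  let ?B = "{i<..min n (2 * i - jaco_indeg i)}"
  \<comment> \<open>This bound gives \<open>i < 2 * i - jaco_indeg i\<close> without truncated
    subtraction, so \<open>?B\<close> is the set of out-neighbours of \<open>i\<close> up to
    \<open>n\<close>.\<close>
  have le: "jaco_indeg i \<le> i - 1"
    by (rule jaco_indeg_le)
  have "{j. (i, j) \<in> parcs (jaco_underlying x n)} = ?A \<union> ?B"
    using assms le by (auto simp: parcs_jaco_underlying)
  moreover have "finite ?A"
    by (rule finite_subset [of _ "{..<i}"]) auto
  then have "card (?A \<union> ?B) = card ?A + card ?B"
    by (intro card_Un_disjoint) auto
  ultimately have "degree (jaco_underlying x n) i = card ?A + card ?B"
    by (simp only: degree_eq_card)
  also have "\<dots> = jaco_indeg i + (min n (2 * i - jaco_indeg i) - i)"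
    by (simp add: jaco_indeg.simps [of i])
  also have "\<dots> = min i (n - i + jaco_indeg i)"
    using assms le by auto
  finally show ?thesis .
qed

lemma max_degree_jaco_underlying_attained:
  assumes "m \<ge> 1"
  obtains k where "k \<in> {1..m}" "max_degree (jaco_underlying x m) = min k (m - k + jaco_indeg k)"
proof -
  have "max_degree (jaco_underlying x m) \<in> degree (jaco_underlying x m) ` {1..m}"
    unfolding max_degree_def pverts_jaco_underlying
    using assms by (intro Max_in) auto
  then show thesis
    using that by (auto simp: degree_jaco_underlying)
qed

text \<open>Let \<open>k\<close> attain the maximum, so \<open>i \<le> k\<close> and
  \<open>i \<le> m - k + jaco_indeg k\<close>. The in-degree grows by at most \<open>k - i\<close>
  between \<open>i\<close> and \<open>k\<close>, whence
  \<open>i \<le> m - i + jaco_indeg i \<le> n - i + jaco_indeg i\<close> and the minimum in the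
  degree formula is \<open>i\<close>.\<close>

lemma degree_jaco_underlying_le_max_degree:
  assumes "1 \<le> i" "i \<le> max_degree (jaco_underlying x m)" "1 \<le> m" "m \<le> n"
  shows "degree (jaco_underlying x n) i = i"
proof -
  obtain k where k: "k \<in> {1..m}" "max_degree (jaco_underlying x m) = min k (m - k + jaco_indeg k)"
    using max_degree_jaco_underlying_attained [OF assms(3)] .
  have "jaco_indeg k \<le> jaco_indeg i + (k - i)"
    using jaco_indeg_add_le [of i "k - i"] k assms by simp
  then show ?thesis
    using k assms by (subst degree_jaco_underlying) auto
qed

section \<open>Comparison of the irregularities block by block\<close>

theorem theorem2p2:
  fixes n m x l :: nat and U :: "(nat + nat) pair_pre_digraph" and v :: "nat \<Rightarrow> nat + nat"
  assumes "n \<ge> 1" and "m \<ge> 1" and "x \<ge> 1"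
    and "U = disjoint_union (jaco_underlying x n) (jaco_underlying x m)"
    and "\<forall>i\<in>{1..n}. v i = Inl i"
    and "\<forall>j\<in>{1..m}. v (n + j) = Inr j"
    and "l = max_degree (jaco_underlying x m)"
  shows "(n > m \<longrightarrow>
      irr_t U \<le> 2 * (irr_t (jaco_underlying x n) + irr_t (jaco_underlying x m))
        + (\<Sum>i=l + 1..n. \<Sum>j=n + l + 1..n + m.
             \<bar>int (degree U (v i)) - int (degree U (v j))\<bar>)) \<and>
    (n = m \<longrightarrow> irr_t U = 4 * irr_t (jaco_underlying x n))"
proof -
  define d where "d k i = int (degree (jaco_underlying x k) i)" for k i
  have irr: "2 * irr_t (jaco_underlying x k) = abs_diff_sum (d k) (d k) {1..k} {1..k}" for k
    using irr_t_eq_abs_diff_sum [of "jaco_underlying x k"]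
    by (simp add: pverts_jaco_underlying d_def [abs_def])
  have U: "irr_t U = irr_t (jaco_underlying x n) + irr_t (jaco_underlying x m) +
      abs_diff_sum (d n) (d m) {1..n} {1..m}"
    using assms(4) irr_t_disjoint_union [of "jaco_underlying x n" "jaco_underlying x m"]
    by (simp add: pverts_jaco_underlying d_def [abs_def])
  have "irr_t U \<le> 2 * (irr_t (jaco_underlying x n) + irr_t (jaco_underlying x m))
        + (\<Sum>i=l + 1..n. \<Sum>j=n + l + 1..n + m. \<bar>int (degree U (v i)) - int (degree U (v j))\<bar>)"
    if "n > m"
  proof -
    \<comment> \<open>The maximum has the form \<open>min k _\<close> with \<open>k \<le> m\<close>.
      Thus \<open>?P\<close> is an initial block of both index ranges.\<close>
    have "l \<le> m"
      using max_degree_jaco_underlying_attained [OF assms(2), of x] assms(7)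
      by (metis atLeastAtMost_iff min.cobounded1 order_trans)
    let ?P = "{1..l}" and ?R = "{l + 1..n}" and ?T = "{l + 1..m}"
    have split: "{1..n} = ?P \<union> ?R" "{1..m} = ?P \<union> ?T"
      using \<open>l \<le> m\<close> \<open>n > m\<close> by auto
    have P: "d k i = int i" if "i \<in> ?P" "m \<le> k" for i k
      using degree_jaco_underlying_le_max_degree [of i x m k] that assms by (simp add: d_def)
    \<comment> \<open>The label \<open>n + j\<close> belongs to vertex \<open>j\<close> of the
      second graph, so shifting the inner index by \<open>n\<close> turns its range into
      \<open>?T\<close>.\<close>
    have RT: "(\<Sum>i=l + 1..n. \<Sum>j=n + l + 1..n + m.
        \<bar>int (degree U (v i)) - int (degree U (v j))\<bar>) = abs_diff_sum (d n) (d m) ?R ?T"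
    proof -
      have "(\<Sum>j=n + l + 1..n + m. \<bar>int (degree U (v i)) - int (degree U (v j))\<bar>) =
          (\<Sum>j\<in>?T. \<bar>d n i - d m j\<bar>)" if "i \<in> ?R" for i
      proof -
        have "(\<Sum>j=n + l + 1..n + m. \<bar>int (degree U (v i)) - int (degree U (v j))\<bar>) =
            (\<Sum>j=l + 1..m. \<bar>int (degree U (v i)) - int (degree U (v (n + j)))\<bar>)"
          using sum.shift_bounds_cl_nat_ivl
            [of "\<lambda>j. \<bar>int (degree U (v i)) - int (degree U (v j))\<bar>" "l + 1" n m]
          by (simp add: add_ac)
        also have "\<dots> = (\<Sum>j\<in>?T. \<bar>d n i - d m j\<bar>)"
          using that assms(4-6) by (intro sum.cong) (auto simp: d_def)
        finally show ?thesis .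
      qed
      then show ?thesis
        by (simp add: abs_diff_sum_def)
    qed
    \<comment> \<open>The two degree sequences agree on \<open>?P\<close>, so every block touching
      \<open>?P\<close> can be written with the pair \<open>d n\<close>, \<open>d m\<close> and
      compared with the mixed sum.\<close>
    have PP: "abs_diff_sum (d n) (d n) ?P ?P = abs_diff_sum (d n) (d m) ?P ?P"
        "abs_diff_sum (d m) (d m) ?P ?P = abs_diff_sum (d n) (d m) ?P ?P"
      and PR: "abs_diff_sum (d n) (d n) ?R ?P = abs_diff_sum (d n) (d m) ?R ?P"
      and PT: "abs_diff_sum (d m) (d m) ?P ?T = abs_diff_sum (d n) (d m) ?P ?T"
      using P \<open>n > m\<close> by (auto intro!: abs_diff_sum_cong)
    have disj: "?P \<inter> ?R = {}" "?P \<inter> ?T = {}"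
      by auto
    have "2 * irr_t (jaco_underlying x n) = abs_diff_sum (d n) (d m) ?P ?P +
        2 * abs_diff_sum (d n) (d m) ?R ?P + abs_diff_sum (d n) (d n) ?R ?R"
      unfolding irr split
      using abs_diff_sum_commute [of "d n" "d n" ?P ?R]
      by (simp add: abs_diff_sum_Un_left abs_diff_sum_Un_right disj PP PR
        del: One_nat_def)
    moreover have "2 * irr_t (jaco_underlying x m) = abs_diff_sum (d n) (d m) ?P ?P +
        2 * abs_diff_sum (d n) (d m) ?P ?T + abs_diff_sum (d m) (d m) ?T ?T"
      unfolding irr split
      using abs_diff_sum_commute [of "d m" "d m" ?T ?P]
      by (simp add: abs_diff_sum_Un_left abs_diff_sum_Un_right disj PP PT
        del: One_nat_def)
    moreover have "abs_diff_sum (d n) (d m) {1..n} {1..m} =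
        abs_diff_sum (d n) (d m) ?P ?P + abs_diff_sum (d n) (d m) ?P ?T +
        abs_diff_sum (d n) (d m) ?R ?P + abs_diff_sum (d n) (d m) ?R ?T"
      unfolding split
      by (simp add: abs_diff_sum_Un_left abs_diff_sum_Un_right disj del: One_nat_def)
    ultimately have "2 * (irr_t (jaco_underlying x n) + irr_t (jaco_underlying x m)) =
        2 * (abs_diff_sum (d n) (d m) {1..n} {1..m} - abs_diff_sum (d n) (d m) ?R ?T) +
        (abs_diff_sum (d n) (d n) ?R ?R + abs_diff_sum (d m) (d m) ?T ?T)"
      by (simp only: distrib_left) simp
    moreover have "0 \<le> abs_diff_sum (d n) (d n) ?R ?R + abs_diff_sum (d m) (d m) ?T ?T"
      by (simp add: abs_diff_sum_nonneg)
    ultimately have "2 * (abs_diff_sum (d n) (d m) {1..n} {1..m} - abs_diff_sum (d n) (d m) ?R ?T) \<le>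
        2 * (irr_t (jaco_underlying x n) + irr_t (jaco_underlying x m))"
      by linarith
    then have "abs_diff_sum (d n) (d m) {1..n} {1..m} - abs_diff_sum (d n) (d m) ?R ?T \<le>
        irr_t (jaco_underlying x n) + irr_t (jaco_underlying x m)"
      by (rule mult_left_le_imp_le) simp
    then show ?thesis
      unfolding U RT by (simp add: algebra_simps)
  qed
  \<comment> \<open>For \<open>n = m\<close> the mixed sum is itself
    \<open>2 * irr_t (jaco_underlying x n)\<close>, added to one copy for each component.\<close>
  moreover have "irr_t U = 4 * irr_t (jaco_underlying x n)" if "n = m"
    using U irr [of n] that by simp
  ultimately show ?thesis by blast
qed

end
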